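(* Let $N,g\ge 1$ be integers and let $\alpha=(\alpha_0,\alpha_1,\dots,\alpha_{g-1})$ be $g$ row vectors in $\mathbb{C}^N$. The following conditions are equivalent. (1) The vectors satisfy $\sum_i\langle\alpha_i,\alpha_{i+j}\rangle=0$ for every integer $j\ne 0$, and $\sum_i\langle\alpha_i,\alpha_i\rangle=1$, where $i$ runs over $\mathbb{Z}$ and $\alpha_i=0$ if $i<0$ or $i\ge g$. (2) There exists a polynomial loop $A(z)\in\mathcal{P}(\mathbb{T},\mathrm{U}(N))$ of degree at most $g-1$ such that the first row of $A(z)$ is $\sum_{i=0}^{g-1}z^i\alpha_i$.
   Context: $\mathbb{T}=\{z\in\mathbb{C}:|z|=1\}$; $\mathrm{U}(N)$ is the group of unitary $N\times N$ complex matrices; $\langle\cdot,\cdot\rangle$ is the standard inner product on $\mathbb{C}^N$. $\mathcal{P}(\mathbb{T},\mathrm{U}(N))$ denotes the set of polynomial loops, i.e. maps $A\colon\mathbb{T}\to\mathrm{U}(N)$ whose matrix entries are polynomials in $z\in\mathbb{T}$; its degree is the largest power of $z$ occurring with nonzero coefficient in its entries, so degree at most $g-1$ means $A(z)=\sum_{k=0}^{g-1}z^kA^{(k)}$ with constant $N\times N$ matrices $A^{(k)}$. *)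

theory Defs
  imports
    "Jordan_Normal_Form.Schur_Decomposition"
    "HOL-Computational_Algebra.Polynomial"
    "HOL-Library.FuncSet"
    "HOL-Library.Groups_Big_Fun"
begin

definition unit_circle :: "complex set" where
  "unit_circle = {z. cmod z = 1}"

definition unitary_group :: "nat \<Rightarrow> complex mat set" where
  "unitary_group N = {A \<in> carrier_mat N N. mat_adjoint A * A = 1\<^sub>m N}"

text \<open>A loop is represented by a function on all of \<^typ>\<open>complex\<close>; only its values on
  the unit circle matter.\<close>

definition polynomial_loops :: "nat \<Rightarrow> (complex \<Rightarrow> complex mat) set" where
  "polynomial_loops N = {A \<in> unit_circle \<rightarrow> unitary_group N.
     \<forall>i<N. \<forall>j<N. \<exists>p :: complex poly. \<forall>z\<in>unit_circle. A z $$ (i, j) = poly p z}"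

text \<open>The polynomial is uniquely determined because the unit circle is infinite
  (\<open>entry_poly_eqI\<close> below).\<close>

definition entry_poly :: "(complex \<Rightarrow> complex mat) \<Rightarrow> nat \<Rightarrow> nat \<Rightarrow> complex poly" where
  "entry_poly A i j = (THE p. \<forall>z\<in>unit_circle. A z $$ (i, j) = poly p z)"

definition loop_degree :: "nat \<Rightarrow> (complex \<Rightarrow> complex mat) \<Rightarrow> nat" where
  "loop_degree N A = Max ((\<lambda>(i, j). degree (entry_poly A i j)) ` ({..<N} \<times> {..<N}))"

definition zero_extension :: "nat \<Rightarrow> nat \<Rightarrow> (nat \<Rightarrow> complex vec) \<Rightarrow> int \<Rightarrow> complex vec" where
  "zero_extension N g \<alpha> i = (if 0 \<le> i \<and> i < int g then \<alpha> (nat i) else 0\<^sub>v N)"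

lemma infinite_unit_circle: "infinite unit_circle"
proof -
  let ?f = "\<lambda>x::real. Complex x (sqrt (1 - x\<^sup>2))"
  have "inj_on ?f {0..1}"
    by (auto simp: inj_on_def)
  moreover have "infinite {0..1::real}"
    by simp
  ultimately have "infinite (?f ` {0..1})"
    using finite_imageD by blast
  moreover have "?f ` {0..1} \<subseteq> unit_circle"
    by (auto simp: unit_circle_def cmod_def power_le_one)
  ultimately show ?thesis
    using finite_subset by blast
qed

lemma poly_eqI_unit_circle:
  fixes p q :: "complex poly"
  assumes "\<And>z. z \<in> unit_circle \<Longrightarrow> poly p z = poly q z"
  shows "p = q"
proof (rule ccontr)
  assume "p \<noteq> q"
  then have "finite {z. poly (p - q) z = 0}"
    by (intro poly_roots_finite) simp
  moreover have "unit_circle \<subseteq> {z. poly (p - q) z = 0}"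
    using assms by auto
  ultimately show False
    using infinite_unit_circle finite_subset by blast
qed

lemma entry_poly_eqI:
  assumes "\<And>z. z \<in> unit_circle \<Longrightarrow> A z $$ (i, j) = poly p z"
  shows "entry_poly A i j = p"
  unfolding entry_poly_def
proof (rule the_equality)
  fix q assume "\<forall>z\<in>unit_circle. A z $$ (i, j) = poly q z"
  then show "q = p"
    using assms by (intro poly_eqI_unit_circle) simp
qed (use assms in simp)

lemma poly_entry_poly:
  assumes "A \<in> polynomial_loops N" "i < N" "j < N" "z \<in> unit_circle"
  shows "poly (entry_poly A i j) z = A z $$ (i, j)"
proof -
  obtain p where "\<And>z. z \<in> unit_circle \<Longrightarrow> A z $$ (i, j) = poly p z"
    using assms(1-3) unfolding polynomial_loops_def by blast
  then show ?thesis
    using entry_poly_eqI[of A i j p] assms(4) by simp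
qed

lemma loop_degree_le_iff:
  assumes "0 < N" and A: "A \<in> polynomial_loops N"
  shows "loop_degree N A \<le> d \<longleftrightarrow>
    (\<exists>C. (\<forall>k\<le>d. C k \<in> carrier_mat N N) \<and>
      (\<forall>z\<in>unit_circle. A z = mat N N (\<lambda>(i, j). \<Sum>k\<le>d. z ^ k * C k $$ (i, j))))"
    (is "_ \<longleftrightarrow> ?R")
proof -
  have iff: "loop_degree N A \<le> d \<longleftrightarrow> (\<forall>i<N. \<forall>j<N. degree (entry_poly A i j) \<le> d)"
    unfolding loop_degree_def using \<open>0 < N\<close> by (subst Max_le_iff) auto
  have dim: "A z \<in> carrier_mat N N" if "z \<in> unit_circle" for z
    using A that unfolding polynomial_loops_def unitary_group_def by auto
  show ?thesis
  proof
    assume "loop_degree N A \<le> d"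
    then have deg: "degree (entry_poly A i j) \<le> d" if "i < N" "j < N" for i j
      using iff that by blast
    let ?C = "\<lambda>k. mat N N (\<lambda>(i, j). coeff (entry_poly A i j) k)"
    have "A z = mat N N (\<lambda>(i, j). \<Sum>k\<le>d. z ^ k * ?C k $$ (i, j))"
      if z: "z \<in> unit_circle" for z
    proof (rule eq_matI)
      fix i j
      assume "i < dim_row (mat N N (\<lambda>(i, j). \<Sum>k\<le>d. z ^ k * ?C k $$ (i, j)))"
        and "j < dim_col (mat N N (\<lambda>(i, j). \<Sum>k\<le>d. z ^ k * ?C k $$ (i, j)))"
      then have ij: "i < N" "j < N" by auto
      have "A z $$ (i, j) = poly (entry_poly A i j) z"
        using poly_entry_poly[OF A ij z] by simp
      also have "\<dots> = (\<Sum>k\<le>d. coeff (entry_poly A i j) k * z ^ k)"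
        by (subst poly_as_sum_of_monoms'[OF deg[OF ij], symmetric]) (simp add: poly_sum poly_monom)
      finally show "A z $$ (i, j) = mat N N (\<lambda>(i, j). \<Sum>k\<le>d. z ^ k * ?C k $$ (i, j)) $$ (i, j)"
        using ij by (simp add: mult.commute)
    qed (use dim[OF z] in auto)
    then show ?R
      by (intro exI[of _ ?C]) auto
  next
    assume ?R
    then obtain C where C: "\<And>z. z \<in> unit_circle \<Longrightarrow>
        A z = mat N N (\<lambda>(i, j). \<Sum>k\<le>d. z ^ k * C k $$ (i, j))"
      by blast
    have "degree (entry_poly A i j) \<le> d" if ij: "i < N" "j < N" for i j
    proof -
      have "entry_poly A i j = (\<Sum>k\<le>d. monom (C k $$ (i, j)) k)"
        by (rule entry_poly_eqI) (use C ij in \<open>simp add: poly_sum poly_monom mult.commute\<close>)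
      also have "degree \<dots> \<le> d"
        by (intro degree_sum_le) (auto intro: order.trans[OF degree_monom_le])
      finally show ?thesis .
    qed
    then show "loop_degree N A \<le> d"
      using iff by blast
  qed
qed

end

theory Submission
  imports Defs
begin

text \<open>The substantial direction completes a row polynomial that is a unit vector at every
  point of the circle to a unitary loop, by induction on the degree \<open>d\<close>. The highest-order
  correlation says that the leading coefficient \<open>\<alpha>\<^sub>d\<close> is orthogonal to the constant one
  \<open>\<alpha>\<^sub>0\<close>. Hence, with \<open>P\<close> the orthogonal projection onto the line of \<open>\<alpha>\<^sub>d\<close>, multiplying the row
  by the unitary \<open>1 - P + z\<^sup>-\<^sup>1P\<close> again gives a polynomial row, of degree at most \<open>d - 1\<close>.
  A completion of the new row, multiplied by \<open>1 - P + zP\<close>, completes the old one.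
  A constant unit row is completed by a complex reflection that takes \<open>e\<^sub>0\<close> to it.\<close>

section \<open>Rank-one updates that preserve the inner product\<close>

text \<open>One formula serves both unitaries of the proof: with \<open>c = (w - 1) / m\<close>,
  where \<open>m\<close> is the squared norm of \<open>u\<close>, it is 1 - P + wP for the
  projection P onto the line of \<open>u\<close>; with another \<open>c\<close> it is the reflection
  that completes a constant row.\<close>

definition rank_one_update ::
    "nat \<Rightarrow> complex \<Rightarrow> (nat \<Rightarrow> complex) \<Rightarrow> (nat \<Rightarrow> complex) \<Rightarrow> nat \<Rightarrow> complex" where
  "rank_one_update N c u x k = x k + c * u k * (\<Sum>l<N. x l * cnj (u l))"

text \<open>With \<open>s\<close> and \<open>t\<close> the inner products of \<open>x\<close> and
  \<open>y\<close> with \<open>u\<close>, expansion leaves the error \<open>s * cnj t\<close> times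
  the left side of the assumption.\<close>

lemma rank_one_update_inner:
  assumes "c + cnj c + c * cnj c * (\<Sum>l<N. u l * cnj (u l)) = 0"
  shows "(\<Sum>k<N. rank_one_update N c u x k * cnj (rank_one_update N c u y k)) =
    (\<Sum>k<N. x k * cnj (y k))"
proof -
  define s where "s = (\<Sum>l<N. x l * cnj (u l))"
  define t where "t = (\<Sum>l<N. y l * cnj (u l))"
  define m where "m = (\<Sum>l<N. u l * cnj (u l))"
  have t: "cnj t = (\<Sum>l<N. u l * cnj (y l))"
    by (simp add: t_def mult.commute)
  have "(\<Sum>k<N. rank_one_update N c u x k * cnj (rank_one_update N c u y k)) =
    (\<Sum>k<N. x k * cnj (y k) + cnj c * cnj t * (x k * cnj (u k)) + c * s * (u k * cnj (y k))
      + c * cnj c * s * cnj t * (u k * cnj (u k)))"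
    unfolding rank_one_update_def s_def[symmetric] t_def[symmetric]
    by (intro sum.cong refl) (simp add: algebra_simps)
  also have "\<dots> = (\<Sum>k<N. x k * cnj (y k)) + cnj c * cnj t * s + c * s * cnj t
      + c * cnj c * s * cnj t * m"
    by (simp only: sum.distrib sum_distrib_left[symmetric] s_def t m_def)
  also have "\<dots> = (\<Sum>k<N. x k * cnj (y k)) + s * cnj t * (c + cnj c + c * cnj c * m)"
    by (simp add: algebra_simps)
  finally show ?thesis
    using assms by (simp add: m_def)
qed

lemma unit_circle_mult_cnj: "z \<in> unit_circle \<Longrightarrow> z * cnj z = 1"
  by (simp add: unit_circle_def complex_norm_square[symmetric])

text \<open>For \<open>u = 0\<close> the factor \<open>(w - 1) / 0\<close> is \<open>0\<close>, so the update is the identity.\<close>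

lemma rank_one_update_unimodular_inner:
  assumes w: "w \<in> unit_circle" and m: "m = (\<Sum>l<N. u l * cnj (u l))"
  shows "(\<Sum>k<N. rank_one_update N ((w - 1) / m) u x k *
      cnj (rank_one_update N ((w - 1) / m) u y k)) = (\<Sum>k<N. x k * cnj (y k))"
proof (rule rank_one_update_inner)
  have "cnj m = m"
    by (simp add: m mult.commute)
  moreover have "(w - 1) + (cnj w - 1) + (w - 1) * (cnj w - 1) = 0"
    using unit_circle_mult_cnj[OF w] by (simp add: algebra_simps)
  ultimately show "(w - 1) / m + cnj ((w - 1) / m) +
      (w - 1) / m * cnj ((w - 1) / m) * (\<Sum>l<N. u l * cnj (u l)) = 0"
    unfolding m[symmetric] by (cases "m = 0") (simp_all add: add_divide_distrib[symmetric])
qed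

lemma sum_mult_cnj_eq_0_iff:
  fixes u :: "nat \<Rightarrow> complex"
  shows "(\<Sum>l<N. u l * cnj (u l)) = 0 \<longleftrightarrow> (\<forall>l<N. u l = 0)"
proof -
  have "(\<Sum>l<N. u l * cnj (u l)) = of_real (\<Sum>l<N. (cmod (u l))\<^sup>2)"
    by (simp add: complex_norm_square del: of_real_power)
  then show ?thesis
    by (simp only: of_real_eq_0_iff) (simp add: sum_nonneg_eq_0_iff Ball_def)
qed

section \<open>Conjugate reversal and the unit-norm condition on the circle\<close>

text \<open>Since \<open>cnj z\<close> is the inverse of \<open>z\<close> on the circle, this
  polynomial represents z^d times the conjugate of p(z). The parameter \<open>d\<close> is not tied
  to \<open>degree p\<close>, so that all entries of a row receive the same factor z^d.\<close>

definition conj_reversal :: "nat \<Rightarrow> complex poly \<Rightarrow> complex poly" where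
  "conj_reversal d p = (\<Sum>k\<le>d. monom (cnj (coeff p (d - k))) k)"

lemma coeff_conj_reversal:
  "coeff (conj_reversal d p) k = (if k \<le> d then cnj (coeff p (d - k)) else 0)"
  by (simp add: conj_reversal_def coeff_sum)

lemma poly_conj_reversal:
  assumes "degree p \<le> d" and z: "z \<in> unit_circle"
  shows "poly (conj_reversal d p) z = z ^ d * cnj (poly p z)"
proof -
  have *: "z ^ (d - k) = z ^ d * cnj z ^ k" if "k \<le> d" for k
  proof -
    have "z ^ d * cnj z ^ k = z ^ (d - k) * (z * cnj z) ^ k"
      using that by (simp add: power_mult_distrib power_add[symmetric] mult.assoc[symmetric])
    then show ?thesis
      by (simp add: unit_circle_mult_cnj[OF z])
  qed
  have "poly p z = (\<Sum>k\<le>d. coeff p k * z ^ k)"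
    by (subst poly_as_sum_of_monoms'[OF assms(1), symmetric]) (simp add: poly_sum poly_monom)
  then have "z ^ d * cnj (poly p z) = (\<Sum>k\<le>d. cnj (coeff p k) * z ^ (d - k))"
    by (simp add: sum_distrib_left * mult_ac)
  also have "\<dots> = (\<Sum>k\<le>d. cnj (coeff p (d - k)) * z ^ k)"
    by (rule sum.reindex_bij_witness[of _ "\<lambda>k. d - k" "\<lambda>k. d - k"]) auto
  finally show ?thesis
    by (simp add: conj_reversal_def poly_sum poly_monom)
qed

text \<open>Multiplying by z^d, which never vanishes on the circle, turns the norm condition into an
  equality of polynomial values; the circle is infinite, so this is an identity of
  polynomials.\<close>

lemma unit_row_iff:
  fixes p :: "nat \<Rightarrow> complex poly"
  assumes "\<And>l. l < N \<Longrightarrow> degree (p l) \<le> d"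
  shows "(\<forall>z\<in>unit_circle. (\<Sum>l<N. poly (p l) z * cnj (poly (p l) z)) = 1) \<longleftrightarrow>
    (\<Sum>l<N. p l * conj_reversal d (p l)) = monom 1 d"
proof -
  have *: "poly (\<Sum>l<N. p l * conj_reversal d (p l)) z =
      z ^ d * (\<Sum>l<N. poly (p l) z * cnj (poly (p l) z))" if "z \<in> unit_circle" for z
    using assms that by (simp add: poly_sum poly_conj_reversal sum_distrib_left mult_ac)
  have nz: "z \<noteq> 0" if "z \<in> unit_circle" for z
    using that by (auto simp: unit_circle_def)
  show ?thesis
  proof
    assume "\<forall>z\<in>unit_circle. (\<Sum>l<N. poly (p l) z * cnj (poly (p l) z)) = 1"
    then show "(\<Sum>l<N. p l * conj_reversal d (p l)) = monom 1 d"
      using * by (intro poly_eqI_unit_circle) (simp add: poly_monom)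
  next
    assume "(\<Sum>l<N. p l * conj_reversal d (p l)) = monom 1 d"
    then have "z ^ d * (\<Sum>l<N. poly (p l) z * cnj (poly (p l) z)) = z ^ d"
      if "z \<in> unit_circle" for z
      using *[OF that] by (simp add: poly_monom)
    then show "\<forall>z\<in>unit_circle. (\<Sum>l<N. poly (p l) z * cnj (poly (p l) z)) = 1"
      using nz by simp
  qed
qed

section \<open>Completing a unit row\<close>

definition orthonormal_rows :: "nat \<Rightarrow> (nat \<Rightarrow> nat \<Rightarrow> complex) \<Rightarrow> bool" where
  "orthonormal_rows N M \<longleftrightarrow>
    (\<forall>i<N. \<forall>j<N. (\<Sum>k<N. M i k * cnj (M j k)) = (if i = j then 1 else 0))"

lemma complete_unit_row:
  assumes "0 < N" and a: "(\<Sum>k<N. a k * cnj (a k)) = 1"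
  shows "\<exists>M. orthonormal_rows N M \<and> (\<forall>k<N. M 0 k = a k)"
proof -
  define e :: "nat \<Rightarrow> nat \<Rightarrow> complex" where "e i k = (if i = k then 1 else 0)" for i k
  define u where "u k = a k - e 0 k" for k
  \<comment> \<open>Chosen so that \<open>c * cnj (u 0) = 1\<close>, which sends \<open>e 0\<close>
    to \<open>e 0 + u\<close>, that is, to \<open>a\<close>. If \<open>a 0 = 1\<close>, then
    \<open>c = 0\<close> by division by zero; the update is the identity, and \<open>a\<close>
    agrees with \<open>e 0\<close> because \<open>u\<close> has norm 0.\<close>
  define c where "c = 1 / (cnj (a 0) - 1)"
  have e_l: "(\<Sum>l<N. e i l * f l) = f i" if "i < N" for i f
    using that by (simp add: e_def if_distrib[of "\<lambda>x. x * _"] cong: if_cong)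
  have cnj_e: "cnj (e i k) = e i k" for i k
    by (simp add: e_def)
  have e_r: "(\<Sum>l<N. f l * e i l) = f i" if "i < N" for i f
    using e_l[OF that, of f] by (simp add: mult.commute)
  have m: "(\<Sum>l<N. u l * cnj (u l)) = 2 - a 0 - cnj (a 0)"
  proof -
    have "(\<Sum>l<N. u l * cnj (u l)) =
        (\<Sum>l<N. a l * cnj (a l) - a l * e 0 l - e 0 l * cnj (a l) + e 0 l * e 0 l)"
      by (intro sum.cong refl) (simp add: u_def cnj_e algebra_simps)
    also have "\<dots> = 1 - a 0 - cnj (a 0) + e 0 0"
      by (simp only: sum.distrib sum_subtractf a e_l[OF assms(1)] e_r[OF assms(1)])
    finally show ?thesis
      by (simp add: e_def)
  qed
  have c: "c + cnj c + c * cnj c * (\<Sum>l<N. u l * cnj (u l)) = 0"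
  proof (cases "a 0 = 1")
    case False
    then have "cnj (a 0) \<noteq> 1" "a 0 \<noteq> 1"
      by (metis complex_cnj_cnj complex_cnj_one)+
    then have "cnj (a 0) - 1 \<noteq> 0" "a 0 - 1 \<noteq> 0"
      by simp_all
    then show ?thesis
      unfolding m c_def by (simp add: divide_simps)
  qed (simp add: c_def)
  let ?M = "\<lambda>i. rank_one_update N c u (e i)"
  have "orthonormal_rows N ?M"
    unfolding orthonormal_rows_def rank_one_update_inner[OF c]
    by (simp add: cnj_e e_l) (simp add: e_def)
  moreover have "?M 0 k = a k" if "k < N" for k
  proof -
    have M: "?M 0 k = e 0 k + c * u k * cnj (u 0)"
      by (simp add: rank_one_update_def e_l[OF assms(1)])
    show ?thesis
    proof (cases "a 0 = 1")
      case True
      then have "\<forall>l<N. u l = 0"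
        using m by (simp add: sum_mult_cnj_eq_0_iff[symmetric])
      then have "u k = 0"
        using that by blast
      then show ?thesis
        by (simp add: M) (simp add: u_def)
    next
      case False
      then have "cnj (a 0) \<noteq> 1"
        by (metis complex_cnj_cnj complex_cnj_one)
      moreover have "cnj (u 0) = cnj (a 0) - 1"
        by (simp add: u_def e_def)
      ultimately have "c * cnj (u 0) = 1"
        by (simp add: c_def)
      then have "c * u k * cnj (u 0) = u k"
        by (simp add: mult_ac)
      then have "?M 0 k = e 0 k + u k"
        by (simp only: M)
      then show ?thesis
        by (simp add: u_def)
    qed
  qed
  ultimately show ?thesis
    by blast
qed

lemma degree_add_smult_le:
  assumes "degree p \<le> d" "degree q \<le> d"
  shows "degree (p + smult c q) \<le> d"
  using assms by (meson degree_add_le degree_smult_le order.trans)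

lemma unitary_completion:
  fixes p :: "nat \<Rightarrow> complex poly"
  assumes "0 < N"
    and "\<And>l. l < N \<Longrightarrow> degree (p l) \<le> d"
    and "\<And>z. z \<in> unit_circle \<Longrightarrow> (\<Sum>l<N. poly (p l) z * cnj (poly (p l) z)) = 1"
  shows "\<exists>Q. (\<forall>i<N. \<forall>k<N. degree (Q i k) \<le> d) \<and> (\<forall>k<N. Q 0 k = p k) \<and>
    (\<forall>z\<in>unit_circle. orthonormal_rows N (\<lambda>i k. poly (Q i k) z))"
  using assms(2,3)
proof (induction d arbitrary: p)
  case 0
  define a where "a k = coeff (p k) 0" for k
  have p: "p k = [:a k:]" if "k < N" for k
    using 0(1)[OF that] by (auto simp: a_def elim: degree_eq_zeroE)
  have "(\<Sum>k<N. a k * cnj (a k)) = 1"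
    using 0(2)[of 1] by (simp add: unit_circle_def p)
  then obtain M where "orthonormal_rows N M" "\<forall>k<N. M 0 k = a k"
    using complete_unit_row[OF assms(1)] by blast
  then show ?case
    by (intro exI[of _ "\<lambda>i k. [:M i k:]"]) (simp add: p)
next
  case (Suc d)
  define a where "a k = coeff (p k) (Suc d)" for k
  define m where "m = (\<Sum>l<N. a l * cnj (a l))"
  define X1 :: "complex poly" where "X1 = [:- 1, 1:]"
  \<comment> \<open>The inner product of the row with its leading vector \<open>a\<close>; the
    component of the row along \<open>a\<close> is \<open>s\<close> times \<open>a / m\<close>. If
    \<open>m = 0\<close>, then \<open>a\<close> vanishes and so does the factor
    \<open>a k / m\<close>.\<close>
  define s where "s = (\<Sum>l<N. smult (cnj (a l)) (p l))"
  have am: "a k / m * m = a k" if "k < N" for k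
    using sum_mult_cnj_eq_0_iff[of a N] that by (cases "m = 0") (auto simp: m_def)
  \<comment> \<open>The constant coefficient of the polynomial identity is the highest-order
    correlation, up to conjugation. It makes \<open>s\<close> divisible by z, with quotient
    \<open>t\<close>.\<close>
  have "coeff (\<Sum>l<N. p l * conj_reversal (Suc d) (p l)) 0 = coeff (monom 1 (Suc d)) 0"
    using unit_row_iff[of N p "Suc d"] Suc.prems by simp
  then have "coeff s 0 = 0"
    by (simp add: s_def coeff_sum coeff_mult coeff_conj_reversal a_def mult.commute)
  then obtain t where st: "s = pCons 0 t"
    by (cases s) auto
  have coeff_s: "coeff s (Suc d) = m"
    by (simp add: s_def coeff_sum a_def m_def mult.commute)
  have deg_s: "degree s \<le> Suc d"
    unfolding s_def
    by (intro degree_sum_le) (auto intro: order.trans[OF degree_smult_le] Suc.prems)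
  then have deg_t: "degree t \<le> d"
    by (cases "t = 0") (auto simp: st)
  \<comment> \<open>Replacing the component \<open>s\<close> along \<open>a\<close> by
    \<open>t = s / z\<close> is multiplication by 1 - P + z^-1 P, carried out within
    polynomials.\<close>
  define q where "q k = p k + smult (a k / m) (t - s)" for k
  have deg_q: "degree (q k) \<le> d" if "k < N" for k
  proof -
    have "degree (q k) \<le> Suc d"
      unfolding q_def using deg_s deg_t Suc.prems(1)[OF that]
      by (intro degree_add_smult_le degree_diff_le) auto
    \<comment> \<open>The term with \<open>t\<close> has too small a degree to contribute, and the
      term with \<open>s\<close> contributes \<open>- (a k / m * m)\<close>, which cancels
      \<open>a k\<close>.\<close>
    moreover have "coeff (q k) (Suc d) = 0"
      using deg_t am[OF that] by (simp add: q_def coeff_s coeff_eq_0 a_def algebra_simps)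
    ultimately show ?thesis
      by (metis degree_0 le_SucE leading_coeff_0_iff zero_le)
  qed
  have unit_q: "(\<Sum>l<N. poly (q l) z * cnj (poly (q l) z)) = 1" if z: "z \<in> unit_circle" for z
  proof -
    have "z \<noteq> 0" and w: "inverse z \<in> unit_circle"
      using z by (auto simp: unit_circle_def norm_inverse)
    have s_z: "(\<Sum>l<N. poly (p l) z * cnj (a l)) = poly s z"
      by (simp add: s_def poly_sum mult.commute)
    have "poly t z = inverse z * poly s z"
      using \<open>z \<noteq> 0\<close> by (simp add: st)
    then have "poly (q k) z =
        rank_one_update N ((inverse z - 1) / m) a (\<lambda>l. poly (p l) z) k" for k
      unfolding rank_one_update_def s_z by (simp add: q_def algebra_simps diff_divide_distrib)
    then show ?thesis
      using Suc.prems(2)[OF z] by (simp add: rank_one_update_unimodular_inner[OF w m_def])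
  qed
  obtain Q where Q: "\<And>i k. i < N \<Longrightarrow> k < N \<Longrightarrow> degree (Q i k) \<le> d"
      "\<And>k. k < N \<Longrightarrow> Q 0 k = q k"
      "\<And>z. z \<in> unit_circle \<Longrightarrow> orthonormal_rows N (\<lambda>i k. poly (Q i k) z)"
    using Suc.IH[of q, OF deg_q unit_q] by blast
  define S where "S i = (\<Sum>l<N. smult (cnj (a l)) (Q i l))" for i
  \<comment> \<open>Each row of \<open>Q\<close> multiplied by 1 - P + zP: \<open>X1\<close> is z -
    1 and \<open>S i\<close> is the inner product of row \<open>i\<close> with \<open>a\<close>. The
    factor \<open>X1\<close> raises the degree by at most one.\<close>
  define R where "R i k = Q i k + smult (a k / m) (X1 * S i)" for i k
  have "degree (R i k) \<le> Suc d" if "i < N" "k < N" for i k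
  proof -
    have "degree (S i) \<le> d"
      unfolding S_def
      by (intro degree_sum_le) (auto intro: order.trans[OF degree_smult_le] Q that)
    then have "degree (X1 * S i) \<le> Suc d"
      using degree_mult_le[of X1 "S i"] by (simp add: X1_def)
    then show ?thesis
      unfolding R_def using Q(1)[OF that] by (intro degree_add_smult_le) auto
  qed
  moreover have "R 0 k = p k" if "k < N" for k
  proof -
    \<comment> \<open>For nonzero \<open>m\<close> the inner product of the row \<open>q\<close>
      with \<open>a\<close> is \<open>t\<close>, and \<open>X1 * t = s - t\<close> undoes the
      passage from \<open>p\<close> to \<open>q\<close>. For \<open>m = 0\<close> both corrections
      vanish.\<close>
    have "S 0 = (\<Sum>l<N. smult (cnj (a l)) (p l) + smult (a l * cnj (a l) / m) (t - s))"
      unfolding S_def by (intro sum.cong refl) (simp add: Q(2) q_def smult_add_right mult.commute)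
    also have "\<dots> = s + smult (m / m) (t - s)"
      by (simp only: sum.distrib smult_sum[symmetric] sum_divide_distrib[symmetric]
          s_def[symmetric] m_def[symmetric])
    finally have "smult (a k / m) (S 0) = smult (a k / m) t"
      by (cases "m = 0") simp_all
    then have "smult (a k / m) (X1 * S 0) = X1 * smult (a k / m) t"
      by (metis mult_smult_right)
    also have "\<dots> = smult (a k / m) (s - t)"
      by (simp add: X1_def st smult_diff_right)
    finally show ?thesis
      using Q(2)[OF that] by (simp add: R_def q_def smult_diff_right)
  qed
  moreover have "orthonormal_rows N (\<lambda>i k. poly (R i k) z)" if z: "z \<in> unit_circle" for z
  proof -
    have S_z: "(\<Sum>l<N. poly (Q i l) z * cnj (a l)) = poly (S i) z" for i
      by (simp add: S_def poly_sum mult.commute)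
    have "poly (R i k) z = rank_one_update N ((z - 1) / m) a (\<lambda>l. poly (Q i l) z) k" for i k
      unfolding rank_one_update_def S_z
      by (simp add: R_def X1_def algebra_simps diff_divide_distrib)
    then show ?thesis
      using Q(3)[OF z]
      by (simp add: orthonormal_rows_def rank_one_update_unimodular_inner[OF z m_def])
  qed
  ultimately show ?case
    by (intro exI[of _ R]) blast
qed

section \<open>Unitary matrices and correlations of the row coefficients\<close>

text \<open>The defining equation concerns columns; a one-sided inverse of a square matrix is
  two-sided, which gives the rows.\<close>

lemma unitary_group_iff_orthonormal_rows:
  assumes A: "A \<in> carrier_mat N N"
  shows "A \<in> unitary_group N \<longleftrightarrow> orthonormal_rows N (\<lambda>i k. A $$ (i, k))"
proof -
  have A': "mat_adjoint A \<in> carrier_mat N N"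
    using A by (simp add: mat_adjoint_def mat_of_rows_def)
  have "mat_adjoint A * A = 1\<^sub>m N \<longleftrightarrow> A * mat_adjoint A = 1\<^sub>m N"
    using mat_mult_left_right_inverse A A' by blast
  moreover have adj: "mat_adjoint A $$ (k, j) = cnj (A $$ (j, k))" if "k < N" "j < N" for k j
    using that A by (simp add: mat_adjoint_def mat_of_rows_index)
  have "(A * mat_adjoint A) $$ (i, j) = (\<Sum>k<N. A $$ (i, k) * cnj (A $$ (j, k)))"
    if "i < N" "j < N" for i j
    using that A A' by (simp add: scalar_prod_def adj lessThan_atLeast0)
  then have "A * mat_adjoint A = 1\<^sub>m N \<longleftrightarrow> orthonormal_rows N (\<lambda>i k. A $$ (i, k))"
    using A A' by (auto simp: mat_eq_iff orthonormal_rows_def)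
  ultimately show ?thesis
    using A by (simp add: unitary_group_def)
qed

text \<open>The shift of the correlation is \<open>d - n\<close> because \<^const>\<open>conj_reversal\<close> multiplies by \<open>z\<^sup>d\<close>.\<close>

lemma coeff_autocorrelation:
  fixes \<alpha> :: "nat \<Rightarrow> complex vec" and p :: "nat \<Rightarrow> complex poly"
  assumes \<alpha>: "\<And>i. i < Suc d \<Longrightarrow> \<alpha> i \<in> carrier_vec N"
    and p: "\<And>l k. l < N \<Longrightarrow> coeff (p l) k = (if k \<le> d then \<alpha> k $ l else 0)"
  shows "coeff (\<Sum>l<N. p l * conj_reversal d (p l)) n =
    Sum_any (\<lambda>i::int. zero_extension N (Suc d) \<alpha> i \<bullet>c
      zero_extension N (Suc d) \<alpha> (i + (int d - int n)))"
proof -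
  let ?\<zeta> = "zero_extension N (Suc d) \<alpha>"
  have carrier: "?\<zeta> i \<in> carrier_vec N" for i
    by (simp add: zero_extension_def \<alpha> nat_less_iff)
  have inner: "?\<zeta> i \<bullet>c ?\<zeta> j = (\<Sum>l<N. ?\<zeta> i $ l * cnj (?\<zeta> j $ l))" for i j
    using carrier[of i] carrier[of j] by (simp add: scalar_prod_def lessThan_atLeast0)
  have p_nonneg: "coeff (p l) k = ?\<zeta> (int k) $ l" if "l < N" for k l
    using that by (simp add: p zero_extension_def)
  \<comment> \<open>Only in the second case are all indices in range, and there
    \<open>d - (n - k)\<close> is the shifted index; in the other three both sides are 0.\<close>
  have summand: "(if k \<le> n then coeff (p l) k * coeff (conj_reversal d (p l)) (n - k) else 0) =
      ?\<zeta> (int k) $ l * cnj (?\<zeta> (int k + (int d - int n)) $ l)" if l: "l < N" for k l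
  proof -
    consider "k > d" | "k \<le> d" "k \<le> n" "n - k \<le> d" | "k \<le> d" "k \<le> n" "n - k > d" | "k \<le> d" "k > n"
      by linarith
    then show ?thesis
    proof cases
      case 2
      then have "int (d - (n - k)) = int k + (int d - int n)"
        by linarith
      then have "coeff (p l) (d - (n - k)) = ?\<zeta> (int k + (int d - int n)) $ l"
        using p_nonneg[OF l, of "d - (n - k)"] by (simp only:)
      then show ?thesis
        using 2 l by (simp add: coeff_conj_reversal p_nonneg)
    qed (use l in \<open>auto simp: coeff_conj_reversal p zero_extension_def\<close>)
  qed
  \<comment> \<open>The bound \<open>max d n\<close> covers both the support 0..d of the zero
    extension and the range 0..n of the Cauchy product.\<close>
  have "Sum_any (\<lambda>i. ?\<zeta> i \<bullet>c ?\<zeta> (i + (int d - int n))) =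
      (\<Sum>i\<in>int ` {..max d n}. ?\<zeta> i \<bullet>c ?\<zeta> (i + (int d - int n)))"
  proof (rule Sum_any.expand_superset)
    show "{i. ?\<zeta> i \<bullet>c ?\<zeta> (i + (int d - int n)) \<noteq> 0} \<subseteq> int ` {..max d n}"
    proof
      fix i assume "i \<in> {i. ?\<zeta> i \<bullet>c ?\<zeta> (i + (int d - int n)) \<noteq> 0}"
      then have "0 \<le> i \<and> i < int (Suc d)"
        unfolding inner by (auto simp: zero_extension_def split: if_splits)
      then show "i \<in> int ` {..max d n}"
        by (intro image_eqI[of _ _ "nat i"]) auto
    qed
  qed simp
  also have "\<dots> = (\<Sum>k\<le>max d n. \<Sum>l<N. ?\<zeta> (int k) $ l * cnj (?\<zeta> (int k + (int d - int n)) $ l))"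
    by (subst sum.reindex) (simp_all add: inner)
  also have "\<dots> = (\<Sum>l<N. \<Sum>k\<le>max d n.
      if k \<le> n then coeff (p l) k * coeff (conj_reversal d (p l)) (n - k) else 0)"
    by (subst sum.swap) (simp add: summand)
  also have "\<dots> = (\<Sum>l<N. \<Sum>k\<le>n. coeff (p l) k * coeff (conj_reversal d (p l)) (n - k))"
    by (intro sum.cong refl sum.mono_neutral_cong_right) auto
  finally show ?thesis
    by (simp add: coeff_sum coeff_mult)
qed

text \<open>Coefficients of index n yield only the shifts d - n, which are at most d. For larger
  shifts, \<open>i\<close> and \<open>i + j\<close> cannot both lie in the range 0..g-1.\<close>

lemma correlation_large_shift:
  assumes "\<And>i. i < g \<Longrightarrow> \<alpha> i \<in> carrier_vec N" and "int g \<le> j"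
  shows "zero_extension N g \<alpha> i \<bullet>c zero_extension N g \<alpha> (i + j) = 0"
proof -
  have "zero_extension N g \<alpha> i = 0\<^sub>v N \<or> zero_extension N g \<alpha> (i + j) = 0\<^sub>v N"
    using assms(2) by (auto simp: zero_extension_def)
  moreover have "zero_extension N g \<alpha> k \<in> carrier_vec N" for k
    using assms(1) by (simp add: zero_extension_def nat_less_iff)
  ultimately show ?thesis
    by (metis carrier_vec_conjugate conjugate_zero_vec scalar_prod_left_zero scalar_prod_right_zero)
qed

text \<open>Comparing coefficients in \<open>unit_row_iff\<close>: \<open>monom 1 d\<close> has its
  only nonzero coefficient at n = d, which is shift 0.\<close>

lemma unit_row_iff_correlation:
  fixes \<alpha> :: "nat \<Rightarrow> complex vec" and p :: "nat \<Rightarrow> complex poly"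
  assumes \<alpha>: "\<And>i. i < Suc d \<Longrightarrow> \<alpha> i \<in> carrier_vec N"
    and p: "\<And>l k. l < N \<Longrightarrow> coeff (p l) k = (if k \<le> d then \<alpha> k $ l else 0)"
  shows "(\<forall>z\<in>unit_circle. (\<Sum>l<N. poly (p l) z * cnj (poly (p l) z)) = 1) \<longleftrightarrow>
    (\<forall>j::int. Sum_any (\<lambda>i::int. zero_extension N (Suc d) \<alpha> i \<bullet>c
      zero_extension N (Suc d) \<alpha> (i + j)) = (if j = 0 then 1 else 0))"
    (is "_ \<longleftrightarrow> (\<forall>j. ?c j = _)")
proof -
  have deg: "degree (p l) \<le> d" if "l < N" for l
    using that by (intro degree_le) (simp add: p)
  have "(\<forall>n. ?c (int d - int n) = coeff (monom 1 d) n) \<longleftrightarrow>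
      (\<forall>j. ?c j = (if j = 0 then 1 else 0))" (is "?L \<longleftrightarrow> ?R")
  proof
    assume L: ?L
    show ?R
    proof
      fix j :: int
      show "?c j = (if j = 0 then 1 else 0)"
      proof (cases "j \<le> int d")
        case True
        then obtain n where "j = int d - int n"
          by (metis add_diff_cancel_left' diff_diff_eq2 zle_iff_zadd)
        then show ?thesis
          using L by simp
      next
        case False
        then show ?thesis
          using correlation_large_shift[of "Suc d" \<alpha> N j, OF \<alpha>] by simp
      qed
    qed
  qed auto
  then show ?thesis
    using unit_row_iff[of N p d, OF deg] by (simp add: poly_eq_iff coeff_autocorrelation[OF \<alpha> p])
qed

theorem theorem4p1:
  fixes N g :: nat and \<alpha> :: "nat \<Rightarrow> complex vec"
  assumes "N \<ge> 1" and "g \<ge> 1"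
    and "\<And>i. i < g \<Longrightarrow> \<alpha> i \<in> carrier_vec N"
  shows
    "((\<forall>j::int. j \<noteq> 0 \<longrightarrow>
         Sum_any (\<lambda>i::int. zero_extension N g \<alpha> i \<bullet>c zero_extension N g \<alpha> (i + j)) = 0) \<and>
      Sum_any (\<lambda>i::int. zero_extension N g \<alpha> i \<bullet>c zero_extension N g \<alpha> i) = 1)
     \<longleftrightarrow>
     (\<exists>A \<in> polynomial_loops N. loop_degree N A \<le> g - 1 \<and>
        (\<forall>z \<in> unit_circle.
           row (A z) 0 = finsum_vec TYPE(complex) N (\<lambda>i. z ^ i \<cdot>\<^sub>v \<alpha> i) {..<g}))"
    (is "?corr \<longleftrightarrow> ?loop")
proof -
  have N: "0 < N"
    using assms(1) by simp
  obtain d where g: "g = Suc d"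
    using assms(2) by (cases g) auto
  have \<alpha>: "\<alpha> i \<in> carrier_vec N" if "i < Suc d" for i
    using assms(3) that g by simp
  define p where "p l = (\<Sum>k\<le>d. monom (\<alpha> k $ l) k)" for l
  have p: "coeff (p l) k = (if k \<le> d then \<alpha> k $ l else 0)" for l k
    by (simp add: p_def coeff_sum)
  have deg: "degree (p l) \<le> d" for l
    by (intro degree_le) (simp add: p)
  let ?row = "\<lambda>z. finsum_vec TYPE(complex) N (\<lambda>i. z ^ i \<cdot>\<^sub>v \<alpha> i) {..<g}"
  have row_carrier: "?row z \<in> carrier_vec N" for z
    by (rule finsum_vec_closed) (use assms(3) in auto)
  have row_index: "?row z $ l = poly (p l) z" if "l < N" for z l
  proof -
    have "?row z $ l = (\<Sum>i<g. (z ^ i \<cdot>\<^sub>v \<alpha> i) $ l)"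
      by (rule index_finsum_vec) (use assms(3) that in auto)
    also have "\<dots> = (\<Sum>i\<le>d. z ^ i * \<alpha> i $ l)"
      using that by (intro sum.cong) (auto simp: g carrier_vecD[OF \<alpha>])
    finally show ?thesis
      by (simp add: p_def poly_sum poly_monom mult.commute)
  qed
  have corr: "?corr \<longleftrightarrow>
      (\<forall>z\<in>unit_circle. (\<Sum>l<N. poly (p l) z * cnj (poly (p l) z)) = 1)"
    using unit_row_iff_correlation[OF \<alpha> p] by (auto simp: g)
  show ?thesis
  proof
    assume ?corr
    then have unit: "(\<Sum>l<N. poly (p l) z * cnj (poly (p l) z)) = 1" if "z \<in> unit_circle" for z
      using corr that by blast
    obtain Q where Q: "\<And>i k. i < N \<Longrightarrow> k < N \<Longrightarrow> degree (Q i k) \<le> d"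
        "\<And>k. k < N \<Longrightarrow> Q 0 k = p k"
        "\<And>z. z \<in> unit_circle \<Longrightarrow> orthonormal_rows N (\<lambda>i k. poly (Q i k) z)"
      using unitary_completion[OF N deg unit] by blast
    define A where "A z = mat N N (\<lambda>(i, k). poly (Q i k) z)" for z
    have "A z \<in> unitary_group N" if "z \<in> unit_circle" for z
      using Q(3)[OF that]
      by (subst unitary_group_iff_orthonormal_rows) (simp_all add: A_def orthonormal_rows_def)
    then have A: "A \<in> polynomial_loops N"
      by (auto simp: polynomial_loops_def A_def)
    \<comment> \<open>Uniqueness of the entry polynomials lets the degree bound on \<open>Q\<close>
      pass to \<open>loop_degree\<close>.\<close>
    have entry: "entry_poly A i k = Q i k" if "i < N" "k < N" for i k
      by (rule entry_poly_eqI) (simp add: A_def that)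
    then have "loop_degree N A \<le> g - 1"
      unfolding loop_degree_def using N Q(1) by (subst Max_le_iff) (auto simp: g)
    moreover have "row (A z) 0 = ?row z" for z
    proof (rule eq_vecI)
      fix l assume "l < dim_vec (?row z)"
      then have "l < N"
        using row_carrier[of z] by simp
      then show "row (A z) 0 $ l = ?row z $ l"
        using N by (simp add: A_def Q(2) row_index)
    qed (use row_carrier[of z] in \<open>simp add: A_def\<close>)
    ultimately show ?loop
      using A by blast
  next
    assume ?loop
    then obtain A where A: "A \<in> polynomial_loops N"
      and row: "\<And>z. z \<in> unit_circle \<Longrightarrow> row (A z) 0 = ?row z"
      by blast
    \<comment> \<open>The first row of a unitary matrix has norm 1.\<close>
    have "(\<Sum>l<N. poly (p l) z * cnj (poly (p l) z)) = 1" if z: "z \<in> unit_circle" for z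
    proof -
      have unitary: "A z \<in> unitary_group N"
        using A z by (auto simp: polynomial_loops_def)
      then have carrier: "A z \<in> carrier_mat N N"
        by (simp add: unitary_group_def)
      have "A z $$ (0, l) = poly (p l) z" if "l < N" for l
        using carrier N that row_index[OF that, of z] by (simp add: row[OF z, symmetric])
      moreover have "(\<Sum>l<N. A z $$ (0, l) * cnj (A z $$ (0, l))) = 1"
        using unitary N unitary_group_iff_orthonormal_rows[OF carrier]
        by (auto simp: orthonormal_rows_def)
      ultimately show ?thesis
        by simp
    qed
    then show ?corr
      using corr by blast
  qed
qed

end
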